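(* Let $0\le\alpha<\frac{\pi}{2}$ and let $A\in\mathcal{S}_\alpha$ be an $n\times n$ complex matrix. Then $$\cos\alpha\,\|A\|\le w(A)\le\|A\|.$$
   Context: $\mathcal{M}_n$ is the algebra of complex $n\times n$ matrices. For $A\in\mathcal{M}_n$: $w(A)=\max\{|\langle Ax,x\rangle|:x\in\mathbb{C}^n,\|x\|=1\}$ is the numerical radius, $\|A\|$ is the operator (spectral) norm, and $W(A)=\{\langle Ax,x\rangle:x\in\mathbb{C}^n,\|x\|=1\}$ is the numerical range. For $0\le\alpha<\pi/2$ let $S_\alpha=\{z\in\mathbb{C}:|\Im z|\le\tan\alpha\,\Re z\}$; we write $A\in\mathcal{S}_\alpha$ if $W(A)\subset S_\alpha$. *)

theory Defs
  imports "HOL-Analysis.Analysis"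
begin

text \<open>
  Vectors of \<open>\<complex>\<^sup>n\<close> are elements of \<^typ>\<open>complex ^ 'n\<close>, whose library norm is the
  Euclidean one.  The library inner product on this type is real-valued, so the sesquilinear
  inner product (conjugate-linear in the second argument) is introduced here; lemma
  \<open>cinner_self\<close> shows that it induces the library norm.
\<close>

definition cinner :: "complex ^ 'n \<Rightarrow> complex ^ 'n \<Rightarrow> complex" where
  "cinner x y = (\<Sum>i\<in>UNIV. x $ i * cnj (y $ i))"

lemma cinner_self: "cinner x x = complex_of_real ((norm x)\<^sup>2)"
  by (simp add: cinner_def norm_vec_def L2_set_def sum_nonneg flip: complex_norm_square of_real_power)

definition numerical_range :: "complex ^ 'n ^ 'n \<Rightarrow> complex set" where
  "numerical_range A = {cinner (A *v x) x | x. norm x = 1}"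

text \<open>
  The supremum below is a maximum, by lemma \<open>numerical_radius_attained\<close> and
  lemma \<open>numerical_radius_upper\<close>.
\<close>

definition numerical_radius :: "complex ^ 'n ^ 'n \<Rightarrow> real" where
  "numerical_radius A = Sup {cmod (cinner (A *v x) x) | x. norm x = 1}"

lemma continuous_on_quadratic_form:
  fixes A :: "complex ^ 'n ^ 'n"
  shows "continuous_on S (\<lambda>x. cmod (cinner (A *v x) x))"
  unfolding cinner_def matrix_vector_mult_def
  by (auto intro!: continuous_intros)

lemma numerical_radius_max:
  fixes A :: "complex ^ 'n ^ 'n"
  shows "\<exists>x. norm x = 1 \<and> cmod (cinner (A *v x) x) = numerical_radius A \<and>
           (\<forall>y. norm y = 1 \<longrightarrow> cmod (cinner (A *v y) y) \<le> numerical_radius A)"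
proof -
  let ?f = "\<lambda>x. cmod (cinner (A *v x) x)"
  have "sphere (0 :: complex ^ 'n) 1 \<noteq> {}"
    by simp
  then obtain x where x: "x \<in> sphere 0 1" and max: "\<forall>y\<in>sphere 0 1. ?f y \<le> ?f x"
    using continuous_attains_sup[OF compact_sphere _ continuous_on_quadratic_form] by blast
  have "numerical_radius A = ?f x"
    unfolding numerical_radius_def using x max by (intro cSup_eq_maximum) auto
  with x max show ?thesis
    by (intro exI[of _ x]) auto
qed

lemma numerical_radius_attained:
  fixes A :: "complex ^ 'n ^ 'n"
  obtains x where "norm x = 1" "cmod (cinner (A *v x) x) = numerical_radius A"
  using numerical_radius_max by blast

lemma numerical_radius_upper:
  "norm x = 1 \<Longrightarrow> cmod (cinner (A *v x) x) \<le> numerical_radius A"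
  using numerical_radius_max by blast

definition sector :: "real \<Rightarrow> complex set" where
  "sector \<alpha> = {z. \<bar>Im z\<bar> \<le> tan \<alpha> * Re z}"

definition sectorial :: "real \<Rightarrow> (complex ^ 'n ^ 'n) set" where
  "sectorial \<alpha> = {A. numerical_range A \<subseteq> sector \<alpha>}"

end

theory Submission
  imports Defs
begin

text \<open>
  Write \<open>a(x, y) = \<langle>A x, y\<rangle>\<close>. For a complex \<open>m\<close> the real part of \<open>m a(x, x)\<close> is half the diagonal
  of the Hermitian form \<open>P\<^sub>m(x, y) = m a(x, y) + cnj (m a(y, x))\<close>. With
  \<open>m = sin \<alpha> - \<i> cos \<alpha>\<close>, membership in the sector says precisely that \<open>P\<^sub>m\<close> and \<open>P\<^sub>m\<^sub>'\<close> are
  positive semidefinite, where \<open>m' = cnj m\<close>; a positive semidefinite form satisfies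
  \<open>2 |P(x, y)| \<le> P(x, x) + P(y, y)\<close>. Moreover \<open>a\<close> is a combination of the two forms:
  \<open>m P\<^sub>m - m' P\<^sub>m\<^sub>' = (m\<^sup>2 - m'\<^sup>2) a\<close> with \<open>|m\<^sup>2 - m'\<^sup>2| = 4 sin \<alpha> cos \<alpha>\<close>. For unit vectors
  this gives \<open>4 sin \<alpha> cos \<alpha> |a(x, y)| \<le> 2 sin \<alpha> Re (a(x, x) + a(y, y)) \<le> 4 sin \<alpha> w(A)\<close>.
  If \<open>\<alpha> = 0\<close> then \<open>A\<close> is Hermitian (not necessarily positive), and polarization with the
  parallelogram law gives \<open>|a(x, y)| \<le> w(A)\<close>.
\<close>

lemma cinner_add_left: "cinner (x + y) z = cinner x z + cinner y z"
  by (simp add: cinner_def sum.distrib algebra_simps)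

lemma cinner_add_right: "cinner z (x + y) = cinner z x + cinner z y"
  by (simp add: cinner_def sum.distrib algebra_simps)

lemma cinner_scale_left: "cinner (c *s x) y = c * cinner x y"
  by (simp add: cinner_def sum_distrib_left algebra_simps)

lemma cinner_scale_right: "cinner x (c *s y) = cnj c * cinner x y"
  by (simp add: cinner_def sum_distrib_left algebra_simps)

lemma cmod_cinner_le: "cmod (cinner x y) \<le> norm x * norm y"
proof -
  have "cmod (cinner x y) \<le> (\<Sum>i\<in>UNIV. \<bar>norm (x $ i)\<bar> * \<bar>norm (y $ i)\<bar>)"
    unfolding cinner_def by (rule order_trans[OF norm_sum]) (simp add: norm_mult)
  also have "\<dots> \<le> norm x * norm y"
    unfolding norm_vec_def by (rule L2_set_mult_ineq)
  finally show ?thesis .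
qed

lemma norm_scale_vec: "norm (c *s (x :: complex ^ 'n)) = cmod c * norm x"
  by (simp add: norm_vec_def norm_mult L2_set_right_distrib)

lemma scaleR_eq_scale_vec: "r *\<^sub>R (x :: complex ^ 'n) = complex_of_real r *s x"
  by (simp add: vec_eq_iff scaleR_conv_of_real[where 'a = complex])

lemma cinner_quadratic_scale:
  "cinner (A *v (c *s x)) (c *s x) = complex_of_real ((cmod c)\<^sup>2) * cinner (A *v x) x"
  by (simp add: vector_scalar_commute cinner_scale_left cinner_scale_right
      complex_norm_square mult.assoc del: of_real_power)

text \<open>Lets degree-two homogeneity carry bounds from unit vectors to all vectors; at zero any
  unit vector serves.\<close>

lemma vec_eq_scale_unit:
  fixes x :: "complex ^ 'n"
  obtains u where "norm u = 1" "x = complex_of_real (norm x) *s u"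
proof (cases "x = 0")
  case True
  obtain u :: "complex ^ 'n" where "norm u = 1"
    using vector_choose_size[of 1] by auto
  with True that show thesis by (simp add: vec_eq_iff)
next
  case False
  then show thesis
    using that[of "sgn x"] by (simp add: norm_sgn sgn_div_norm flip: scaleR_eq_scale_vec)
qed

lemma numerical_radius_quadratic:
  "cmod (cinner (A *v x) x) \<le> numerical_radius A * (norm x)\<^sup>2"
proof -
  obtain u where u: "norm u = 1" and x: "x = complex_of_real (norm x) *s u"
    by (rule vec_eq_scale_unit)
  have "cmod (cinner (A *v x) x) = (norm x)\<^sup>2 * cmod (cinner (A *v u) u)"
    by (subst (1 2) x, subst cinner_quadratic_scale) (simp add: norm_mult norm_power)
  with numerical_radius_upper[OF u, of A] show ?thesis
    by (simp add: mult.commute[of "numerical_radius A"] mult_left_mono)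
qed

definition herm_form :: "complex \<Rightarrow> complex ^ 'n ^ 'n \<Rightarrow> complex ^ 'n \<Rightarrow> complex ^ 'n \<Rightarrow> complex" where
  "herm_form m A x y = m * cinner (A *v x) y + cnj (m * cinner (A *v y) x)"

definition quad_form :: "complex \<Rightarrow> complex ^ 'n ^ 'n \<Rightarrow> complex ^ 'n \<Rightarrow> real" where
  "quad_form m A x = Re (m * cinner (A *v x) x)"

lemma quad_form_add_scale:
  assumes "cmod u = 1"
  shows "quad_form m A (x + u *s y)
    = quad_form m A x + quad_form m A y + Re (cnj u * herm_form m A x y)"
proof -
  have "cnj u * u = 1"
    using assms by (simp add: mult.commute flip: complex_norm_square)
  then have "cnj u * (u * b) = b" for b
    by (simp flip: mult.assoc)
  then have "cinner (A *v (x + u *s y)) (x + u *s y)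
    = cinner (A *v x) x + cinner (A *v y) y + cnj u * cinner (A *v x) y + u * cinner (A *v y) x"
    by (simp add: distrib_left matrix_vector_right_distrib cinner_add_left cinner_add_right
        vector_scalar_commute cinner_scale_left cinner_scale_right)
  then show ?thesis
    by (simp add: quad_form_def herm_form_def algebra_simps)
qed

text \<open>Taking \<open>u\<close> as the phase of \<open>herm_form m A x y\<close> turns the cross
  term into its modulus, and \<open>- u\<close> flips its sign.\<close>

lemma quad_form_extremal:
  obtains u where "cmod u = 1"
    "quad_form m A (x + u *s y) = quad_form m A x + quad_form m A y + cmod (herm_form m A x y)"
    "quad_form m A (x + (- u) *s y) = quad_form m A x + quad_form m A y - cmod (herm_form m A x y)"
proof -
  let ?P = "herm_form m A x y"
  \<comment> \<open>The default 1 keeps \<open>u\<close> unimodular, since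
    \<open>sgn 0 = 0\<close>.\<close>
  define u where "u = (if ?P = 0 then 1 else sgn ?P)"
  have u: "cmod u = 1"
    by (simp add: u_def norm_sgn)
  have "u * complex_of_real (cmod ?P) = ?P"
    by (simp add: u_def sgn_eq)
  then have "cnj u * ?P = (u * cnj u) * complex_of_real (cmod ?P)"
    by (metis mult.assoc mult.commute)
  also have "u * cnj u = 1"
    using u by (simp flip: complex_norm_square)
  finally have "cnj u * ?P = complex_of_real (cmod ?P)"
    by simp
  with u show thesis
    using that[of u] quad_form_add_scale[of u m A x y] quad_form_add_scale[of "- u" m A x y]
    by simp
qed

text \<open>The smaller extremal value, at \<open>x + (- u) *s y\<close>, is nonnegative.\<close>

lemma herm_form_bound_psd:
  assumes "\<And>z. 0 \<le> quad_form m A z"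
  shows "cmod (herm_form m A x y) \<le> quad_form m A x + quad_form m A y"
  by (metis assms quad_form_extremal diff_ge_0_iff_ge)

lemma parallelogram_scale_vec:
  fixes x y :: "complex ^ 'n"
  assumes "cmod u = 1"
  shows "(norm (x + u *s y))\<^sup>2 + (norm (x + (- u) *s y))\<^sup>2 = 2 * (norm x)\<^sup>2 + 2 * (norm y)\<^sup>2"
proof -
  have "(norm (u *s y))\<^sup>2 = (norm y)\<^sup>2"
    by (simp add: norm_scale_vec assms)
  moreover have "(- u) *s y = - (u *s y)"
    by (simp add: vec_eq_iff)
  ultimately show ?thesis
    by (simp add: power2_norm_eq_inner inner_simps)
qed

text \<open>Polarization: the two extremal values differ by twice the modulus, and the parallelogram
  law sums their bounds.\<close>

lemma herm_form_bound_numerical_radius: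
  assumes "cmod m = 1" "norm x = 1" "norm y = 1"
  shows "cmod (herm_form m A x y) \<le> 2 * numerical_radius A"
proof -
  have q: "\<bar>quad_form m A z\<bar> \<le> numerical_radius A * (norm z)\<^sup>2" for z
    unfolding quad_form_def
    using abs_Re_le_cmod[of "m * cinner (A *v z) z"] numerical_radius_quadratic[of A z] assms(1)
    by (simp add: norm_mult)
  obtain u where u: "cmod u = 1"
    "quad_form m A (x + u *s y) = quad_form m A x + quad_form m A y + cmod (herm_form m A x y)"
    "quad_form m A (x + (- u) *s y) = quad_form m A x + quad_form m A y - cmod (herm_form m A x y)"
    by (rule quad_form_extremal)
  have "2 * cmod (herm_form m A x y)
      \<le> numerical_radius A * ((norm (x + u *s y))\<^sup>2 + (norm (x + (- u) *s y))\<^sup>2)"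
    using q[of "x + u *s y"] q[of "x + (- u) *s y"] u(2,3) by (simp only: distrib_left)
  also have "\<dots> = 4 * numerical_radius A"
    unfolding parallelogram_scale_vec[OF u(1)] by (simp add: assms)
  finally show ?thesis
    by simp
qed

lemma sectorial_quadratic:
  assumes "A \<in> sectorial \<alpha>"
  shows "\<bar>Im (cinner (A *v x) x)\<bar> \<le> tan \<alpha> * Re (cinner (A *v x) x)"
proof -
  obtain u where u: "norm u = 1" and x: "x = complex_of_real (norm x) *s u"
    by (rule vec_eq_scale_unit)
  have "\<bar>Im (cinner (A *v u) u)\<bar> \<le> tan \<alpha> * Re (cinner (A *v u) u)"
    using assms u by (auto simp: sectorial_def numerical_range_def sector_def)
  then have "(norm x)\<^sup>2 * \<bar>Im (cinner (A *v u) u)\<bar> \<le> (norm x)\<^sup>2 * (tan \<alpha> * Re (cinner (A *v u) u))"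
    by (rule mult_left_mono) simp
  moreover have "cinner (A *v x) x = complex_of_real ((norm x)\<^sup>2) * cinner (A *v u) u"
    by (subst (1 2) x, subst cinner_quadratic_scale) simp
  ultimately show ?thesis
    by (simp add: abs_mult algebra_simps del: of_real_power)
qed

lemma sectorial_form_bound_pos:
  assumes "0 < \<alpha>" "\<alpha> < pi / 2" "A \<in> sectorial \<alpha>" "norm x = 1" "norm y = 1"
  shows "cos \<alpha> * cmod (cinner (A *v x) y) \<le> numerical_radius A"
proof -
  \<comment> \<open>\<open>Re (m * z)\<close> and \<open>Re (cnj m * z)\<close> are
    \<open>sin \<alpha> * Re z\<close> plus and minus \<open>cos \<alpha> * Im z\<close>, so the two
    edges of the sector are their zero sets.\<close>
  define m where "m = Complex (sin \<alpha>) (- cos \<alpha>)"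
  have s: "sin \<alpha> > 0" and c: "cos \<alpha> > 0"
    using assms by (auto intro: sin_gt_zero cos_gt_zero)
  have m: "cmod m = 1"
    by (simp add: m_def cmod_def)
  have sec: "cos \<alpha> * \<bar>Im (cinner (A *v z) z)\<bar> \<le> sin \<alpha> * Re (cinner (A *v z) z)" for z
    using sectorial_quadratic[OF assms(3), of z] c by (simp add: tan_def field_simps)
  have "0 \<le> quad_form m A z \<and> 0 \<le> quad_form (cnj m) A z" for z
  proof -
    have "\<bar>cos \<alpha> * Im (cinner (A *v z) z)\<bar> \<le> sin \<alpha> * Re (cinner (A *v z) z)"
      using sec[of z] c by (simp add: abs_mult)
    then show ?thesis
      by (simp add: quad_form_def m_def abs_le_iff)
  qed
  then have P: "cmod (herm_form m A x y) + cmod (herm_form (cnj m) A x y)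
      \<le> quad_form m A x + quad_form m A y + quad_form (cnj m) A x + quad_form (cnj m) A y"
    using herm_form_bound_psd[of m A x y] herm_form_bound_psd[of "cnj m" A x y] by auto
  have "quad_form m A z + quad_form (cnj m) A z \<le> 2 * sin \<alpha> * numerical_radius A"
    if "norm z = 1" for z
  proof -
    have "quad_form m A z + quad_form (cnj m) A z = 2 * sin \<alpha> * Re (cinner (A *v z) z)"
      by (simp add: quad_form_def m_def)
    also have "\<dots> \<le> 2 * sin \<alpha> * numerical_radius A"
      using complex_Re_le_cmod[of "cinner (A *v z) z"] numerical_radius_upper[OF that, of A] s
      by (intro mult_left_mono) auto
    finally show ?thesis .
  qed
  from P this[OF assms(4)] this[OF assms(5)] have P': "cmod (herm_form m A x y) + cmod (herm_form (cnj m) A x y)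
      \<le> 4 * sin \<alpha> * numerical_radius A"
    by linarith
  have "m\<^sup>2 - (cnj m)\<^sup>2 = Complex 0 (- 4 * sin \<alpha> * cos \<alpha>)"
    by (simp add: m_def complex_eq_iff power2_eq_square)
  then have "cmod (m\<^sup>2 - (cnj m)\<^sup>2) = 4 * sin \<alpha> * cos \<alpha>"
    using s c by (simp add: cmod_def abs_mult)
  then have "4 * sin \<alpha> * (cos \<alpha> * cmod (cinner (A *v x) y))
      = cmod ((m\<^sup>2 - (cnj m)\<^sup>2) * cinner (A *v x) y)"
    by (simp add: norm_mult)
  \<comment> \<open>The terms in \<open>cinner (A *v y) x\<close> cancel: both carry the factor
    \<open>m * cnj m\<close>.\<close>
  also have "(m\<^sup>2 - (cnj m)\<^sup>2) * cinner (A *v x) y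
      = m * herm_form m A x y - cnj m * herm_form (cnj m) A x y"
    by (simp add: herm_form_def algebra_simps power2_eq_square)
  also have "cmod \<dots> \<le> cmod (herm_form m A x y) + cmod (herm_form (cnj m) A x y)"
    using norm_triangle_ineq4[of "m * herm_form m A x y" "cnj m * herm_form (cnj m) A x y"] m
    by (simp add: norm_mult)
  also note P'
  finally show ?thesis
    \<comment> \<open>Cancelling \<open>4 * sin \<alpha>\<close> is where
      \<open>0 < \<alpha>\<close> enters.\<close>
    using s by simp
qed

lemma sectorial_zero_form_bound:
  assumes "A \<in> sectorial 0" "norm x = 1" "norm y = 1"
  shows "cmod (cinner (A *v x) y) \<le> numerical_radius A"
proof -
  \<comment> \<open>As \<open>tan 0 = 0\<close>, the quadratic form is real; with
    \<open>m = \<i>\<close> the semidefinite bound then becomes 0 and forces Hermitian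
    symmetry.\<close>
  have "quad_form \<i> A z = 0" for z
    using sectorial_quadratic[OF assms(1), of z] by (simp add: quad_form_def)
  then have "herm_form \<i> A x y = 0"
    using herm_form_bound_psd[of \<i> A x y] by simp
  then have "cnj (cinner (A *v y) x) = cinner (A *v x) y"
    by (simp add: herm_form_def)
  then have "herm_form 1 A x y = 2 * cinner (A *v x) y"
    by (simp add: herm_form_def)
  then show ?thesis
    using herm_form_bound_numerical_radius[of 1 x y A] assms by (simp add: norm_mult)
qed

text \<open>Testing \<open>A *v u\<close> against its own direction recovers its norm.\<close>

lemma onorm_le_of_form_bound:
  fixes A :: "complex ^ 'n ^ 'n"
  assumes "\<And>x y. norm x = 1 \<Longrightarrow> norm y = 1 \<Longrightarrow> cmod (cinner (A *v x) y) \<le> K"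
  shows "onorm ((*v) A) \<le> K"
proof (rule onorm_le)
  fix x :: "complex ^ 'n"
  obtain u where u: "norm u = 1" and x: "x = complex_of_real (norm x) *s u"
    by (rule vec_eq_scale_unit)
  obtain v where v: "norm v = 1" and Au: "A *v u = complex_of_real (norm (A *v u)) *s v"
    by (rule vec_eq_scale_unit)
  have "cmod (cinner (A *v u) v) = norm (A *v u)"
    by (subst Au) (simp add: cinner_scale_left cinner_self v)
  then have "norm (A *v u) \<le> K"
    using assms[OF u v] by simp
  moreover have "norm (A *v x) = norm x * norm (A *v u)"
    by (subst x) (simp add: vector_scalar_commute norm_scale_vec)
  ultimately show "norm (A *v x) \<le> K * norm x"
    by (simp add: mult.commute[of K] mult_left_mono)
qed

lemma bounded_linear_complex_matrix:
  "bounded_linear ((*v) (A :: complex ^ 'n ^ 'n))"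
  by (intro linear_conv_bounded_linear[THEN iffD1] linearI)
    (simp_all add: matrix_vector_right_distrib scaleR_eq_scale_vec vector_scalar_commute)

theorem proposition3p1:
  fixes A :: "complex ^ 'n ^ 'n" and \<alpha> :: real
  assumes "0 \<le> \<alpha>" and "\<alpha> < pi / 2"
    and "A \<in> sectorial \<alpha>"
  shows "cos \<alpha> * onorm ((*v) A) \<le> numerical_radius A \<and> numerical_radius A \<le> onorm ((*v) A)"
proof
  have c: "cos \<alpha> > 0"
    using assms by (intro cos_gt_zero_pi) auto
  have "cos \<alpha> * cmod (cinner (A *v x) y) \<le> numerical_radius A"
    if "norm x = 1" "norm y = 1" for x y
    using sectorial_form_bound_pos[of \<alpha> A x y] sectorial_zero_form_bound[of A x y] assms that
    by (cases "\<alpha> = 0") auto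
  then have "onorm ((*v) A) \<le> numerical_radius A / cos \<alpha>"
    using c by (intro onorm_le_of_form_bound) (simp add: field_simps)
  then show "cos \<alpha> * onorm ((*v) A) \<le> numerical_radius A"
    using c by (simp add: field_simps)
next
  obtain x where x: "norm x = 1" "cmod (cinner (A *v x) x) = numerical_radius A"
    by (rule numerical_radius_attained)
  \<comment> \<open>Cauchy-Schwarz at a unit vector attaining the numerical radius.\<close>
  then have "numerical_radius A \<le> norm (A *v x)"
    using cmod_cinner_le[of "A *v x" x] by simp
  also have "\<dots> \<le> onorm ((*v) A)"
    using onorm[OF bounded_linear_complex_matrix, of A x] x by simp
  finally show "numerical_radius A \<le> onorm ((*v) A)" .
qed

end
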